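(* Let $\mathcal{R}$ be a commutative ring with unity, let $\mathcal{A}$ be a unital $\mathcal{R}$-algebra, and let $\mathcal{M}$ be a unital $\mathcal{A}$-bimodule. Let $n\ge 2$ and let $$f(x_1,\ldots,x_n)=\sum_{\pi\in S_n}\alpha_\pi x_{\pi(1)}x_{\pi(2)}\cdots x_{\pi(n)},\qquad \alpha_\pi\in\mathcal{R},$$ be a nonzero multilinear polynomial in noncommuting indeterminates over $\mathcal{R}$, and put $\alpha=\sum_{\pi\in S_n}\alpha_\pi\in\mathcal{R}$. Let $F:\mathcal{A}\times\mathcal{A}\to\mathcal{M}$ be an $f$-biderivation, with $\alpha\neq 0$. If $\mathcal{M}$ is $(n-1)$-torsion free and $\alpha$ is $\mathcal{M}$-regular, then $F$ is a Jordan biderivation.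
   Context: $S_n$ is the symmetric group on $\{1,\dots,n\}$. If one of the arguments $x_i$ of $f$ lies in $\mathcal{M}$ and all the others lie in $\mathcal{A}$, then $f(x_1,\dots,x_n)\in\mathcal{M}$ is computed using the bimodule actions. An $\mathcal{R}$-bilinear map $F:\mathcal{A}\times\mathcal{A}\to\mathcal{M}$ is an $f$-biderivation if for all $x_1,\ldots,x_n,z\in\mathcal{A}$ $$F(f(x_1,\ldots,x_n),z)=\sum_{i=1}^n f(x_1,\ldots,x_{i-1},F(x_i,z),x_{i+1},\ldots,x_n)$$ and $$F(z,f(x_1,\ldots,x_n))=\sum_{i=1}^n f(x_1,\ldots,x_{i-1},F(z,x_i),x_{i+1},\ldots,x_n).$$ A Jordan biderivation is a $g$-biderivation for the polynomial $g(x,y)=xy+yx$. $\mathcal{M}$ is $(n-1)$-torsion free if $(n-1)m=0$ with $m\in\mathcal{M}$ implies $m=0$. An element $r\in\mathcal{R}$ is $\mathcal{M}$-regular if for every $m\in\mathcal{M}$, $rm=0$ implies $m=0$. *)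

theory Defs
  imports Complex_Main "HOL-Combinatorics.Permutations"
begin

(* The sort {ring, monoid_mult} is that of unital rings in which 0 = 1 is allowed; ring_1 would
   exclude the zero algebra. *)

locale unital_algebra = module scaleA
  for scaleA :: "'r::comm_ring_1 \<Rightarrow> 'a::{ring,monoid_mult} \<Rightarrow> 'a" +
  assumes scale_mult_left: "scaleA r x * y = scaleA r (x * y)"
    and scale_mult_right: "x * scaleA r y = scaleA r (x * y)"

(* lact a m is the left action a m, ract m a the right action m a.  As usual for bimodules over an
   R-algebra, both actions are R-bilinear for one and the same R-module structure on M,
   that is, (r 1) m = r m = m (r 1). *)

locale unital_bimodule = A: unital_algebra scaleA + M: module scaleM
  for scaleA :: "'r::comm_ring_1 \<Rightarrow> 'a::{ring,monoid_mult} \<Rightarrow> 'a"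
    and scaleM :: "'r \<Rightarrow> 'm::ab_group_add \<Rightarrow> 'm" +
  fixes lact :: "'a \<Rightarrow> 'm \<Rightarrow> 'm" and ract :: "'m \<Rightarrow> 'a \<Rightarrow> 'm"
  assumes lact_add_left: "lact (a + b) m = lact a m + lact b m"
    and lact_add_right: "lact a (m + m') = lact a m + lact a m'"
    and lact_mult: "lact (a * b) m = lact a (lact b m)"
    and lact_one: "lact 1 m = m"
    and ract_add_left: "ract (m + m') a = ract m a + ract m' a"
    and ract_add_right: "ract m (a + b) = ract m a + ract m b"
    and ract_mult: "ract m (a * b) = ract (ract m a) b"
    and ract_one: "ract m 1 = m"
    and lact_ract: "ract (lact a m) b = lact a (ract m b)"
    and lact_scaleA: "lact (scaleA r a) m = scaleM r (lact a m)"
    and lact_scaleM: "lact a (scaleM r m) = scaleM r (lact a m)"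
    and ract_scaleA: "ract m (scaleA r a) = scaleM r (ract m a)"
    and ract_scaleM: "ract (scaleM r m) a = scaleM r (ract m a)"

(* A multilinear polynomial of degree n is given by its coefficient family \<alpha>, of which only the
   values at permutations of {1..n} matter: the monomials x_(\<pi> 1) ... x_(\<pi> n) are pairwise
   distinct words, so the polynomial is nonzero iff one of these coefficients is. *)

definition mlpoly_nonzero :: "nat \<Rightarrow> ((nat \<Rightarrow> nat) \<Rightarrow> 'r::comm_ring_1) \<Rightarrow> bool" where
  "mlpoly_nonzero n \<alpha> \<longleftrightarrow> (\<exists>\<pi>. \<pi> permutes {1..n} \<and> \<alpha> \<pi> \<noteq> 0)"

definition mlpoly_eval ::
    "('r::comm_ring_1 \<Rightarrow> 'a::{ring,monoid_mult} \<Rightarrow> 'a) \<Rightarrow> nat \<Rightarrow> ((nat \<Rightarrow> nat) \<Rightarrow> 'r) \<Rightarrow>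
      (nat \<Rightarrow> 'a) \<Rightarrow> 'a" where
  "mlpoly_eval scaleA n \<alpha> x =
    (\<Sum>\<pi> | \<pi> permutes {1..n}. scaleA (\<alpha> \<pi>) (prod_list (map (\<lambda>k. x (\<pi> k)) [1..<Suc n])))"

(* f(x_1,...,x_(i-1), m, x_(i+1),...,x_n) with m in M; x i is ignored.  In the monomial of \<pi>
   the variable x_i stands at position inv \<pi> i. *)

definition mlpoly_eval_at ::
    "('r::comm_ring_1 \<Rightarrow> 'm::ab_group_add \<Rightarrow> 'm) \<Rightarrow> ('a::{ring,monoid_mult} \<Rightarrow> 'm \<Rightarrow> 'm) \<Rightarrow>
      ('m \<Rightarrow> 'a \<Rightarrow> 'm) \<Rightarrow> nat \<Rightarrow> ((nat \<Rightarrow> nat) \<Rightarrow> 'r) \<Rightarrow> (nat \<Rightarrow> 'a) \<Rightarrow> nat \<Rightarrow> 'm \<Rightarrow> 'm" where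
  "mlpoly_eval_at scaleM lact ract n \<alpha> x i m =
    (\<Sum>\<pi> | \<pi> permutes {1..n}. scaleM (\<alpha> \<pi>)
      (lact (prod_list (map (\<lambda>k. x (\<pi> k)) [1..<inv \<pi> i]))
        (ract m (prod_list (map (\<lambda>k. x (\<pi> k)) [Suc (inv \<pi> i)..<Suc n])))))"

definition bilinear_map ::
    "('r::comm_ring_1 \<Rightarrow> 'a::{ring,monoid_mult} \<Rightarrow> 'a) \<Rightarrow> ('r \<Rightarrow> 'm::ab_group_add \<Rightarrow> 'm) \<Rightarrow>
      ('a \<Rightarrow> 'a \<Rightarrow> 'm) \<Rightarrow> bool" where
  "bilinear_map scaleA scaleM F \<longleftrightarrow>
    (\<forall>z. module_hom scaleA scaleM (\<lambda>x. F x z)) \<and> (\<forall>z. module_hom scaleA scaleM (\<lambda>x. F z x))"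

definition f_biderivation ::
    "('r::comm_ring_1 \<Rightarrow> 'a::{ring,monoid_mult} \<Rightarrow> 'a) \<Rightarrow> ('r \<Rightarrow> 'm::ab_group_add \<Rightarrow> 'm) \<Rightarrow>
      ('a \<Rightarrow> 'm \<Rightarrow> 'm) \<Rightarrow> ('m \<Rightarrow> 'a \<Rightarrow> 'm) \<Rightarrow> nat \<Rightarrow> ((nat \<Rightarrow> nat) \<Rightarrow> 'r) \<Rightarrow> ('a \<Rightarrow> 'a \<Rightarrow> 'm) \<Rightarrow> bool" where
  "f_biderivation scaleA scaleM lact ract n \<alpha> F \<longleftrightarrow>
    bilinear_map scaleA scaleM F \<and>
    (\<forall>x z. F (mlpoly_eval scaleA n \<alpha> x) z =
        (\<Sum>i=1..n. mlpoly_eval_at scaleM lact ract n \<alpha> x i (F (x i) z))) \<and>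
    (\<forall>x z. F z (mlpoly_eval scaleA n \<alpha> x) =
        (\<Sum>i=1..n. mlpoly_eval_at scaleM lact ract n \<alpha> x i (F z (x i))))"

(* The polynomial xy + yx: n = 2 and both coefficients equal to 1. *)

definition Jordan_biderivation ::
    "('r::comm_ring_1 \<Rightarrow> 'a::{ring,monoid_mult} \<Rightarrow> 'a) \<Rightarrow> ('r \<Rightarrow> 'm::ab_group_add \<Rightarrow> 'm) \<Rightarrow>
      ('a \<Rightarrow> 'm \<Rightarrow> 'm) \<Rightarrow> ('m \<Rightarrow> 'a \<Rightarrow> 'm) \<Rightarrow> ('a \<Rightarrow> 'a \<Rightarrow> 'm) \<Rightarrow> bool" where
  "Jordan_biderivation scaleA scaleM lact ract F \<longleftrightarrow>
    f_biderivation scaleA scaleM lact ract 2 (\<lambda>_. 1) F"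

definition torsion_free :: "nat \<Rightarrow> 'm::ab_group_add itself \<Rightarrow> bool" where
  "torsion_free k _ \<longleftrightarrow> (\<forall>m::'m. (\<Sum>i<k. m) = 0 \<longrightarrow> m = 0)"

definition regular_on :: "('r::comm_ring_1 \<Rightarrow> 'm::ab_group_add \<Rightarrow> 'm) \<Rightarrow> 'r \<Rightarrow> bool" where
  "regular_on scaleM r \<longleftrightarrow> (\<forall>m. scaleM r m = 0 \<longrightarrow> m = 0)"


lemma permutations_1_2:
  "{\<pi>. \<pi> permutes {1..2::nat}} = {id, transpose 1 2}"
proof -
  have "{1..2::nat} = {1, 2}" by auto
  then show ?thesis by (auto simp: permutes_doubleton_iff permutes_id permutes_swap_id)
qed

lemma (in unital_bimodule) Jordan_biderivation_iff:
  "Jordan_biderivation scaleA scaleM lact ract F \<longleftrightarrow>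
    bilinear_map scaleA scaleM F \<and>
    (\<forall>x y z. F (x * y + y * x) z =
      ract (F x z) y + lact x (F y z) + ract (F y z) x + lact y (F x z)) \<and>
    (\<forall>x y z. F z (x * y + y * x) =
      ract (F z x) y + lact x (F z y) + ract (F z y) x + lact y (F z x))"
proof -
  have neq: "id \<noteq> transpose 1 (2::nat)"
    by (metis id_apply one_eq_numeral_iff semiring_norm(83) transpose_apply_first numeral_One)
  have u: "[1..<Suc 2] = [1, 2]" "[Suc 1..<Suc 2] = [2]" "[1..<(2::nat)] = [1]" "[Suc 2..<Suc 2] = []"
    by (simp_all add: upt_rec)
  have e: "mlpoly_eval scaleA 2 (\<lambda>_. 1) x = x 1 * x 2 + x 2 * x 1" for x
    unfolding mlpoly_eval_def permutations_1_2 using neq by (simp only: u sum.insert finite.intros sum.empty) (simp add: u del: upt_Suc One_nat_def)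
  have s: "(\<Sum>i=1..2::nat. g i) = g 1 + g 2" for g :: "nat \<Rightarrow> 'm"
    by (simp add: numeral_2_eq_2)
  have a1: "mlpoly_eval_at scaleM lact ract 2 (\<lambda>_. 1) x 1 m = ract m (x 2) + lact (x 2) m" for x m
    unfolding mlpoly_eval_at_def permutations_1_2 using neq
    by (simp add: u lact_one ract_one del: upt_Suc One_nat_def)
  have a2: "mlpoly_eval_at scaleM lact ract 2 (\<lambda>_. 1) x 2 m = lact (x 1) m + ract m (x 1)" for x m
    unfolding mlpoly_eval_at_def permutations_1_2 using neq
    by (simp add: u lact_one ract_one del: upt_Suc One_nat_def)
  have q: "(\<forall>x z. P (x 1) (x (2::nat)) z) \<longleftrightarrow> (\<forall>x y z. P x y z)" for P :: "'a \<Rightarrow> 'a \<Rightarrow> 'a \<Rightarrow> bool"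
  proof (intro iffI allI)
    fix x y z assume h: "\<forall>x z. P (x 1) (x (2::nat)) z"
    show "P x y z" using h[rule_format, of "\<lambda>k. if k = 1 then x else y" z] by simp
  qed blast
  show ?thesis
    unfolding Jordan_biderivation_def f_biderivation_def e s a1 a2
    using q[of "\<lambda>x y z. F (x * y + y * x) z =
      ract (F x z) y + lact y (F x z) + (lact x (F y z) + ract (F y z) x)"]
      q[of "\<lambda>x y z. F z (x * y + y * x) =
      ract (F z x) y + lact y (F z x) + (lact x (F z y) + ract (F z y) x)"]
    by (simp add: ac_simps)
qed

end

theory Submission
  imports Defs
begin

text \<open>
  Fixing one argument of \<open>F\<close> leaves a linear map \<open>d\<close> that satisfies the Leibniz rule of \<open>f\<close> in the
  other argument, so it suffices to show that such a \<open>d\<close> is a Jordan derivation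
  (\<open>f_derivation_jordan\<close>).

  Substituting \<open>1\<close> for every variable turns each monomial into \<open>1\<close> and the Leibniz rule into
  \<open>\<alpha> d(1) = n \<alpha> d(1)\<close>; torsion freeness and regularity of \<open>\<alpha>\<close> then give \<open>d(1) = 0\<close>
  (\<open>f_derivation_one\<close>). Consequently, when \<open>1\<close> is substituted for all but two variables, only the
  summands of the Leibniz rule that belong to these two variables survive. If the two variables take
  the values \<open>a\<close> and \<open>b\<close>, the monomials of \<open>f\<close> collapse to \<open>ab\<close> or \<open>ba\<close>, depending on which of the
  two variables comes first, so \<open>f\<close> becomes \<open>\<beta> ab + \<gamma> ba\<close> with \<open>\<beta> + \<gamma> = \<alpha>\<close>. Nothing is known about
  \<open>\<beta>\<close> and \<open>\<gamma>\<close> separately, but adding the identity with \<open>a\<close> and \<open>b\<close> interchanged produces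
  \<open>\<alpha> (ab + ba)\<close> on one side and \<open>\<alpha>\<close> times the Jordan Leibniz expression on the other, and \<open>\<alpha>\<close> can
  be cancelled.
\<close>

lemma prod_list_map_single:
  fixes g :: "'k \<Rightarrow> 'a::monoid_mult"
  assumes "distinct ks" and "\<And>k. k \<in> set ks \<Longrightarrow> k \<noteq> p \<Longrightarrow> g k = 1"
  shows "prod_list (map g ks) = (if p \<in> set ks then g p else 1)"
  using assms
proof (induction ks)
  case (Cons k ks)
  then show ?case by (cases "k = p") auto
qed simp

lemma prod_list_map_upt_pair:
  fixes g :: "nat \<Rightarrow> 'a::monoid_mult"
  assumes "i \<le> p" "p < q" "q < j" and one: "\<And>k. k \<noteq> p \<Longrightarrow> k \<noteq> q \<Longrightarrow> g k = 1"
  shows "prod_list (map g [i..<j]) = g p * g q"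
proof -
  have "[i..<j] = [i..<q] @ [q..<j]"
    using assms by (metis le_add_diff_inverse less_imp_le_nat order_trans upt_add_eq_append)
  moreover have "prod_list (map g [i..<q]) = g p"
    using assms by (subst prod_list_map_single[where p = p]) auto
  moreover have "prod_list (map g [q..<j]) = g q"
    using assms by (subst prod_list_map_single[where p = q]) auto
  ultimately show ?thesis by simp
qed

lemma permutes_inv_eq_imp_eq:
  assumes "\<pi> permutes S" and "inv \<pi> i = inv \<pi> j"
  shows "i = j"
  using assms by (metis permutes_inverses(1))

lemma permutes_inv_less_iff_not:
  fixes i j :: nat
  assumes "\<pi> permutes S" and "i \<noteq> j"
  shows "inv \<pi> j < inv \<pi> i \<longleftrightarrow> \<not> inv \<pi> i < inv \<pi> j"
  using permutes_inv_eq_imp_eq[OF assms(1)] assms(2) by (metis less_asym' linorder_neqE_nat)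

lemma permutes_inv_in_interval:
  fixes i n :: nat
  assumes "\<pi> permutes {1..n}" and "i \<in> {1..n}"
  shows "1 \<le> inv \<pi> i" "inv \<pi> i \<le> n"
  using permutes_in_image[OF permutes_inv[OF assms(1)], of i] assms(2) by auto

lemma prod_list_monomial_pair:
  fixes a b :: "'a::monoid_mult" and i j n :: nat
  assumes \<pi>: "\<pi> permutes {1..n}" and ij: "i \<in> {1..n}" "j \<in> {1..n}" "i \<noteq> j"
  shows "prod_list (map (\<lambda>k. ((\<lambda>_. 1)(i := a, j := b)) (\<pi> k)) [1..<Suc n]) =
    (if inv \<pi> i < inv \<pi> j then a * b else b * a)"
proof -
  let ?x = "(\<lambda>_. 1)(i := a, j := b)"
  have at: "?x (\<pi> (inv \<pi> i)) = a" "?x (\<pi> (inv \<pi> j)) = b"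
    using ij by (simp_all add: permutes_inverses[OF \<pi>])
  have one: "?x (\<pi> k) = 1" if "k \<noteq> inv \<pi> i" "k \<noteq> inv \<pi> j" for k
    using that by (auto simp: permutes_inverses[OF \<pi>])
  note bounds = permutes_inv_in_interval[OF \<pi> ij(1)] permutes_inv_in_interval[OF \<pi> ij(2)]
  show ?thesis
  proof (cases "inv \<pi> i < inv \<pi> j")
    case True
    show ?thesis
      using prod_list_map_upt_pair[of 1 "inv \<pi> i" "inv \<pi> j" "Suc n" "\<lambda>k. ?x (\<pi> k)"]
        True bounds at one by (simp del: upt_Suc fun_upd_apply)
  next
    case False
    then have "inv \<pi> j < inv \<pi> i"
      using permutes_inv_less_iff_not[OF \<pi> ij(3)] by simp
    then show ?thesis
      using prod_list_map_upt_pair[of 1 "inv \<pi> j" "inv \<pi> i" "Suc n" "\<lambda>k. ?x (\<pi> k)"]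
        False bounds at one by (simp del: upt_Suc fun_upd_apply)
  qed
qed

context unital_bimodule
begin

lemma lact_zero [simp]: "lact a 0 = 0"
  using lact_add_right[of a 0 0] by simp

lemma ract_zero [simp]: "ract 0 a = 0"
  using ract_add_left[of 0 0 a] by simp

text \<open>The part of \<open>f_biderivation\<close> that concerns one argument while the other one is fixed.\<close>

definition f_derivation :: "nat \<Rightarrow> ((nat \<Rightarrow> nat) \<Rightarrow> 'r) \<Rightarrow> ('a \<Rightarrow> 'm) \<Rightarrow> bool" where
  "f_derivation n \<alpha> d \<longleftrightarrow> module_hom scaleA scaleM d \<and>
    (\<forall>x. d (mlpoly_eval scaleA n \<alpha> x) =
      (\<Sum>i=1..n. mlpoly_eval_at scaleM lact ract n \<alpha> x i (d (x i))))"

lemma f_biderivation_iff_f_derivation: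
  "f_biderivation scaleA scaleM lact ract n \<alpha> F \<longleftrightarrow>
    (\<forall>z. f_derivation n \<alpha> (\<lambda>x. F x z)) \<and> (\<forall>z. f_derivation n \<alpha> (F z))"
  unfolding f_biderivation_def bilinear_map_def f_derivation_def by auto

lemma mlpoly_eval_ones:
  "mlpoly_eval scaleA n \<alpha> (\<lambda>_. 1) = scaleA (\<Sum>\<pi> | \<pi> permutes {1..n}. \<alpha> \<pi>) 1"
  unfolding mlpoly_eval_def
  by (simp add: map_replicate_const A.scale_sum_left del: upt_Suc)

lemma mlpoly_eval_at_ones:
  "mlpoly_eval_at scaleM lact ract n \<alpha> (\<lambda>_. 1) i m = scaleM (\<Sum>\<pi> | \<pi> permutes {1..n}. \<alpha> \<pi>) m"
  unfolding mlpoly_eval_at_def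
  by (simp add: map_replicate_const lact_one ract_one M.scale_sum_left del: upt_Suc)

lemma mlpoly_eval_at_zero: "mlpoly_eval_at scaleM lact ract n \<alpha> x i 0 = 0"
  unfolding mlpoly_eval_at_def by simp

lemma mlpoly_eval_pair:
  assumes "i \<in> {1..n}" "j \<in> {1..n}" "i \<noteq> j"
  shows "mlpoly_eval scaleA n \<alpha> ((\<lambda>_. 1)(i := a, j := b)) =
    (\<Sum>\<pi> | \<pi> permutes {1..n}. scaleA (\<alpha> \<pi>) (if inv \<pi> i < inv \<pi> j then a * b else b * a))"
  unfolding mlpoly_eval_def using assms
  by (intro sum.cong refl arg_cong[where f = "scaleA _"]) (rule prod_list_monomial_pair, auto)

lemma mlpoly_eval_at_pair:
  assumes ij: "i \<in> {1..n}" "j \<in> {1..n}" "i \<noteq> j"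
  shows "mlpoly_eval_at scaleM lact ract n \<alpha> ((\<lambda>_. 1)(i := a, j := b)) i m =
    (\<Sum>\<pi> | \<pi> permutes {1..n}. scaleM (\<alpha> \<pi>) (if inv \<pi> i < inv \<pi> j then ract m b else lact b m))"
  unfolding mlpoly_eval_at_def
proof (intro sum.cong refl arg_cong[where f = "scaleM _"])
  fix \<pi> assume "\<pi> \<in> {\<pi>. \<pi> permutes {1..n}}"
  then have \<pi>: "\<pi> permutes {1..n}" by simp
  let ?x = "(\<lambda>_. 1)(i := a, j := b)"
  have at: "?x (\<pi> (inv \<pi> j)) = b"
    by (simp add: permutes_inverses[OF \<pi>])
  have one: "?x (\<pi> k) = 1" if "k \<noteq> inv \<pi> i" "k \<noteq> inv \<pi> j" for k
    using that by (auto simp: permutes_inverses[OF \<pi>])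
  note bounds = permutes_inv_in_interval[OF \<pi> ij(2)]
  have before: "prod_list (map (\<lambda>k. ?x (\<pi> k)) [1..<inv \<pi> i]) = (if inv \<pi> j < inv \<pi> i then b else 1)"
    using one at bounds
    by (subst prod_list_map_single[where p = "inv \<pi> j"]) (auto simp del: fun_upd_apply)
  have after: "prod_list (map (\<lambda>k. ?x (\<pi> k)) [Suc (inv \<pi> i)..<Suc n]) =
      (if inv \<pi> i < inv \<pi> j then b else 1)"
    using one at bounds
    by (subst prod_list_map_single[where p = "inv \<pi> j"]) (auto simp del: fun_upd_apply upt_Suc)
  show "lact (prod_list (map (\<lambda>k. ?x (\<pi> k)) [1..<inv \<pi> i]))
      (ract m (prod_list (map (\<lambda>k. ?x (\<pi> k)) [Suc (inv \<pi> i)..<Suc n]))) =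
    (if inv \<pi> i < inv \<pi> j then ract m b else lact b m)"
    unfolding before after
    using permutes_inv_less_iff_not[OF \<pi> ij(3)] by (simp add: lact_one ract_one)
qed

text \<open>The substitution of \<open>1\<close> for all variables yields \<open>(n - 1) \<alpha> d(1) = 0\<close>.\<close>

lemma f_derivation_one:
  assumes d: "f_derivation n \<alpha> d" and n: "n \<ge> 1"
    and tf: "torsion_free (n - 1) TYPE('m)"
    and reg: "regular_on scaleM (\<Sum>\<pi> | \<pi> permutes {1..n}. \<alpha> \<pi>)"
  shows "d 1 = 0"
proof -
  let ?m = "scaleM (\<Sum>\<pi> | \<pi> permutes {1..n}. \<alpha> \<pi>) (d 1)"
  interpret d: module_hom scaleA scaleM d
    using d by (simp add: f_derivation_def)
  have "d (mlpoly_eval scaleA n \<alpha> (\<lambda>_. 1)) =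
      (\<Sum>i=1..n. mlpoly_eval_at scaleM lact ract n \<alpha> (\<lambda>_. 1) i (d 1))"
    using d by (simp add: f_derivation_def)
  then have "?m = (\<Sum>i=1..n. ?m)"
    unfolding mlpoly_eval_ones mlpoly_eval_at_ones d.scale .
  also have "\<dots> = (\<Sum>i<Suc (n - 1). ?m)"
    using n by (intro sum.reindex_bij_witness[of _ Suc "\<lambda>i. i - 1"]) auto
  also have "\<dots> = (\<Sum>i<n - 1. ?m) + ?m"
    by (rule sum.lessThan_Suc)
  finally have "(\<Sum>i<n - 1. ?m) = 0"
    by (rule add_cancel_right_left[THEN iffD1])
  then have "?m = 0"
    using tf by (simp only: torsion_free_def)
  then show ?thesis
    using reg by (simp only: regular_on_def)
qed

text \<open>
  Each monomial contributes the Leibniz rule of \<open>ab\<close> or that of \<open>ba\<close>, with the same choice on both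
  sides; the other summands of the Leibniz rule of \<open>f\<close> contain \<open>d(1)\<close>.
\<close>

lemma f_derivation_pair:
  assumes d: "f_derivation n \<alpha> d" and d1: "d 1 = 0"
    and ij: "i \<in> {1..n}" "j \<in> {1..n}" "i \<noteq> j"
  shows "d (\<Sum>\<pi> | \<pi> permutes {1..n}. scaleA (\<alpha> \<pi>) (if inv \<pi> i < inv \<pi> j then a * b else b * a)) =
    (\<Sum>\<pi> | \<pi> permutes {1..n}. scaleM (\<alpha> \<pi>)
      (if inv \<pi> i < inv \<pi> j then ract (d a) b + lact a (d b) else ract (d b) a + lact b (d a)))"
proof -
  let ?x = "(\<lambda>_. 1)(i := a, j := b)"
  let ?e = "mlpoly_eval_at scaleM lact ract n \<alpha> ?x"
  have "d (mlpoly_eval scaleA n \<alpha> ?x) = (\<Sum>k=1..n. ?e k (d (?x k)))"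
    using d unfolding f_derivation_def by blast
  also have "\<dots> = (\<Sum>k\<in>{i, j}. ?e k (d (?x k)))"
    using ij by (intro sum.mono_neutral_right) (auto simp: d1 mlpoly_eval_at_zero)
  also have "\<dots> = ?e i (d a) + ?e j (d b)"
    using ij by simp
  also have "?e j (d b) = (\<Sum>\<pi> | \<pi> permutes {1..n}. scaleM (\<alpha> \<pi>)
      (if inv \<pi> j < inv \<pi> i then ract (d b) a else lact a (d b)))"
    using mlpoly_eval_at_pair[of j n i \<alpha> b a] ij by (simp add: fun_upd_twist)
  also have "?e i (d a) + \<dots> = (\<Sum>\<pi> | \<pi> permutes {1..n}. scaleM (\<alpha> \<pi>)
      (if inv \<pi> i < inv \<pi> j then ract (d a) b + lact a (d b) else ract (d b) a + lact b (d a)))"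
    unfolding mlpoly_eval_at_pair[OF ij] sum.distrib[symmetric]
    using permutes_inv_less_iff_not[OF _ ij(3)]
    by (intro sum.cong) (auto simp: M.scale_right_distrib add.commute)
  finally show ?thesis
    by (simp only: mlpoly_eval_pair[OF ij])
qed

lemma f_derivation_jordan:
  assumes d: "f_derivation n \<alpha> d" and n: "n \<ge> 2"
    and tf: "torsion_free (n - 1) TYPE('m)"
    and reg: "regular_on scaleM (\<Sum>\<pi> | \<pi> permutes {1..n}. \<alpha> \<pi>)"
  shows "d (a * b + b * a) = ract (d a) b + lact a (d b) + ract (d b) a + lact b (d a)"
proof -
  let ?P = "{\<pi>. \<pi> permutes {1..n}}"
  let ?\<alpha> = "\<Sum>\<pi>\<in>?P. \<alpha> \<pi>"
  let ?p = "\<lambda>a b. \<Sum>\<pi>\<in>?P. scaleA (\<alpha> \<pi>) (if inv \<pi> 1 < inv \<pi> 2 then a * b else b * a)"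
  let ?L = "\<lambda>a b. ract (d a) b + lact a (d b)"
  let ?q = "\<lambda>a b. \<Sum>\<pi>\<in>?P. scaleM (\<alpha> \<pi>) (if inv \<pi> 1 < inv \<pi> 2 then ?L a b else ?L b a)"
  interpret d: module_hom scaleA scaleM d
    using d by (simp add: f_derivation_def)
  have pair: "d (?p a b) = ?q a b" for a b
    using f_derivation_pair[OF d f_derivation_one[OF d _ tf reg], of 1 2 a b] n by simp
  have "scaleA ?\<alpha> (a * b + b * a) = ?p a b + ?p b a"
    unfolding A.scale_sum_left sum.distrib[symmetric]
    by (intro sum.cong refl) (simp add: A.scale_right_distrib add.commute)
  then have "d (scaleA ?\<alpha> (a * b + b * a)) = ?q a b + ?q b a"
    by (simp only: d.add[of "?p a b" "?p b a"] pair)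
  then have "scaleM ?\<alpha> (d (a * b + b * a)) = ?q a b + ?q b a"
    by (simp only: d.scale)
  also have "\<dots> = scaleM ?\<alpha> (?L a b + ?L b a)"
    unfolding M.scale_sum_left sum.distrib[symmetric]
    by (intro sum.cong refl) (simp add: M.scale_right_distrib ac_simps)
  finally have "scaleM ?\<alpha> (d (a * b + b * a) - (?L a b + ?L b a)) = 0"
    by (simp only: M.scale_right_diff_distrib diff_self)
  then have "d (a * b + b * a) - (?L a b + ?L b a) = 0"
    using reg unfolding regular_on_def by blast
  then show ?thesis by (simp add: add.assoc)
qed

end

theorem theorem2p1:
  fixes scaleA :: "'r::comm_ring_1 \<Rightarrow> 'a::{ring,monoid_mult} \<Rightarrow> 'a"
    and scaleM :: "'r \<Rightarrow> 'm::ab_group_add \<Rightarrow> 'm"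
    and lact :: "'a \<Rightarrow> 'm \<Rightarrow> 'm" and ract :: "'m \<Rightarrow> 'a \<Rightarrow> 'm"
    and n :: nat and \<alpha> :: "(nat \<Rightarrow> nat) \<Rightarrow> 'r" and F :: "'a \<Rightarrow> 'a \<Rightarrow> 'm"
  assumes "unital_bimodule scaleA scaleM lact ract"
    and "n \<ge> 2"
    and "mlpoly_nonzero n \<alpha>"
    and "f_biderivation scaleA scaleM lact ract n \<alpha> F"
    and "(\<Sum>\<pi> | \<pi> permutes {1..n}. \<alpha> \<pi>) \<noteq> 0"
    and "torsion_free (n - 1) TYPE('m)"
    and "regular_on scaleM (\<Sum>\<pi> | \<pi> permutes {1..n}. \<alpha> \<pi>)"
  shows "Jordan_biderivation scaleA scaleM lact ract F"
proof -
  interpret unital_bimodule scaleA scaleM lact ract by fact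
  have "f_derivation n \<alpha> (\<lambda>x. F x z)" and "f_derivation n \<alpha> (F z)" for z
    using assms(4) by (simp_all add: f_biderivation_iff_f_derivation)
  note jordan = this[THEN f_derivation_jordan, OF assms(2,6,7)]
  have "bilinear_map scaleA scaleM F"
    using assms(4) by (simp add: f_biderivation_def)
  then show ?thesis
    unfolding Jordan_biderivation_iff using jordan by blast
qed

end
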